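(* Let $d\ge 1$ and $l>0$, and let $X$ be the space of non-empty connected compact sets $S\subset\mathbb{R}^d$ with $\mathcal{H}^1(S)\le l$, equipped with the Hausdorff distance. Let $(M_i)_{i\in\mathbb{N}}$ be a sequence of non-empty compact subsets of $\mathbb{R}^d$ converging in the Hausdorff distance to a non-empty compact set $M\subset\mathbb{R}^d$. Then the functionals $F_{M_i}:X\to\overline{\mathbb{R}}$ $\Gamma$-converge to $F_M:X\to\overline{\mathbb{R}}$.
   Context: $\mathcal{H}^1$ denotes one-dimensional Hausdorff measure and $\mathrm{dist}$ the Euclidean distance. For a compact set $M\subset\mathbb{R}^d$ and $S\in X$, put $F_M(S):=\max_{y\in M}\mathrm{dist}(y,S)$. The Hausdorff distance $d_H(A,C)$ between non-empty compact sets $A,C$ is the smallest $\rho\ge 0$ such that every point of $A$ is at distance at most $\rho$ from $C$ and every point of $C$ is at distance at most $\rho$ from $A$. Functionals $F_n:X\to\overline{\mathbb{R}}$ on a first-countable space $X$ are said to $\Gamma$-converge to $F:X\to\overline{\mathbb{R}}$ if: (1) for every $x\in X$ and every sequence $x_n\in X$ with $x_n\to x$ one has $F(x)\le\liminf_{n\to\infty}F_n(x_n)$; and (2) for every $x\in X$ there is a sequence $x_n\in X$ converging to $x$ such that $F(x)\ge\limsup_{n\to\infty}F_n(x_n)$. *)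

theory Defs
  imports "HOL-Analysis.Analysis"
begin

definition hausdorff_bound :: "'a::metric_space set \<Rightarrow> 'a set \<Rightarrow> real \<Rightarrow> bool" where
  "hausdorff_bound A C \<rho> \<longleftrightarrow>
     0 \<le> \<rho> \<and> (\<forall>a\<in>A. infdist a C \<le> \<rho>) \<and> (\<forall>c\<in>C. infdist c A \<le> \<rho>)"

text \<open>The value outside the non-empty compact sets is arbitrary; it is set to 0 because
  the locale \<open>Metric_space\<close> asks for non-negativity and symmetry on the whole type.
  That the least bound exists is shown below (\<open>hausdorff_dist_least\<close>).\<close>

definition hausdorff_dist :: "'a::metric_space set \<Rightarrow> 'a set \<Rightarrow> real" where
  "hausdorff_dist A C =
     (if A \<noteq> {} \<and> compact A \<and> C \<noteq> {} \<and> compact C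
      then (LEAST \<rho>. hausdorff_bound A C \<rho>) else 0)"

lemma infdist_le_diameter_union:
  fixes A C :: "'a::metric_space set"
  assumes "compact A" "compact C" "C \<noteq> {}" "a \<in> A"
  shows "infdist a C \<le> diameter (A \<union> C)"
proof -
  obtain c where c: "c \<in> C" using assms by blast
  have "infdist a C \<le> dist a c" using c by (rule infdist_le)
  also have "\<dots> \<le> diameter (A \<union> C)"
    using assms c by (intro diameter_bounded_bound) (auto intro: compact_imp_bounded)
  finally show ?thesis .
qed

lemma hausdorff_dist_least:
  fixes A C :: "'a::metric_space set"
  assumes "A \<noteq> {}" "compact A" "C \<noteq> {}" "compact C"
  shows "hausdorff_bound A C (hausdorff_dist A C)"
    and "hausdorff_bound A C \<rho> \<Longrightarrow> hausdorff_dist A C \<le> \<rho>"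
proof -
  let ?B = "{\<rho>. hausdorff_bound A C \<rho>}"
  let ?m = "Inf ?B"
  have bb: "bdd_below ?B" by (rule bdd_belowI[of _ 0]) (auto simp: hausdorff_bound_def)
  have "hausdorff_bound A C (diameter (A \<union> C))"
    unfolding hausdorff_bound_def
  proof (intro conjI ballI)
    show "0 \<le> diameter (A \<union> C)" using assms by (simp add: diameter_ge_0 compact_imp_bounded)
    show "infdist a C \<le> diameter (A \<union> C)" if "a \<in> A" for a
      using infdist_le_diameter_union[of A C a] assms that by blast
    show "infdist c A \<le> diameter (A \<union> C)" if "c \<in> C" for c
      using infdist_le_diameter_union[of C A c] assms that by (simp add: Un_commute)
  qed
  then have ne: "?B \<noteq> {}" by blast
  have "0 \<le> ?m \<and> (\<forall>a\<in>A. infdist a C \<le> ?m) \<and> (\<forall>c\<in>C. infdist c A \<le> ?m)"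
  proof (intro conjI ballI)
    show "0 \<le> ?m" using ne by (intro cInf_greatest) (auto simp: hausdorff_bound_def)
    show "infdist a C \<le> ?m" if "a \<in> A" for a
      using ne that by (intro cInf_greatest) (auto simp: hausdorff_bound_def)
    show "infdist c A \<le> ?m" if "c \<in> C" for c
      using ne that by (intro cInf_greatest) (auto simp: hausdorff_bound_def)
  qed
  then have m: "hausdorff_bound A C ?m" by (subst hausdorff_bound_def)
  have le: "?m \<le> r" if "hausdorff_bound A C r" for r
    using that bb by (auto intro: cInf_lower)
  have eq: "hausdorff_dist A C = ?m"
    using assms m le by (auto simp: hausdorff_dist_def intro!: Least_equality)
  show "hausdorff_bound A C (hausdorff_dist A C)" using m eq by simp
  show "hausdorff_bound A C \<rho> \<Longrightarrow> hausdorff_dist A C \<le> \<rho>" using le eq by simp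
qed

lemma hausdorff_dist_infdist_le:
  fixes A C :: "'a::metric_space set"
  assumes "A \<noteq> {}" "compact A" "C \<noteq> {}" "compact C"
  shows "a \<in> A \<Longrightarrow> infdist a C \<le> hausdorff_dist A C"
    and "c \<in> C \<Longrightarrow> infdist c A \<le> hausdorff_dist A C"
  using hausdorff_dist_least(1)[OF assms] by (auto simp: hausdorff_bound_def)

lemma hausdorff_dist_nonneg: "0 \<le> hausdorff_dist A C"
proof (cases "A \<noteq> {} \<and> compact A \<and> C \<noteq> {} \<and> compact C")
  case True
  then show ?thesis using hausdorff_dist_least(1)[of A C] by (auto simp: hausdorff_bound_def)
qed (auto simp: hausdorff_dist_def)

lemma hausdorff_dist_commute: "hausdorff_dist A C = hausdorff_dist C A"
proof -
  have "hausdorff_bound A C = hausdorff_bound C A"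
    by (rule ext) (auto simp: hausdorff_bound_def)
  then show ?thesis by (auto simp: hausdorff_dist_def)
qed

lemma infdist_triangle_hausdorff:
  fixes A B C :: "'a::metric_space set"
  assumes "A \<noteq> {}" "compact A" "B \<noteq> {}" "compact B" "C \<noteq> {}" "compact C" "a \<in> A"
  shows "infdist a C \<le> hausdorff_dist A B + hausdorff_dist B C"
proof -
  have "continuous_on B (dist a)" by (intro continuous_intros)
  then obtain b where bmin: "b \<in> B" "\<forall>z\<in>B. dist a b \<le> dist a z"
    using continuous_attains_inf[of B "dist a"] assms by blast
  have b: "b \<in> B" "infdist a B = dist a b"
    using bmin assms unfolding infdist_def by (auto intro!: cInf_eq_minimum)
  have "infdist a C \<le> infdist b C + dist a b" by (rule infdist_triangle)
  also have "infdist b C \<le> hausdorff_dist B C"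
    using assms b by (intro hausdorff_dist_infdist_le) auto
  also have "dist a b \<le> hausdorff_dist A B"
    using assms b hausdorff_dist_infdist_le(1)[of A B a] by simp
  finally show ?thesis by simp
qed

lemma Metric_space_hausdorff_dist:
  fixes \<C> :: "'a::metric_space set set"
  assumes "\<And>S. S \<in> \<C> \<Longrightarrow> S \<noteq> {} \<and> compact S"
  shows "Metric_space \<C> hausdorff_dist"
proof
  show "0 \<le> hausdorff_dist A B" for A B :: "'a set" by (rule hausdorff_dist_nonneg)
  show "hausdorff_dist A B = hausdorff_dist B A" for A B :: "'a set"
    by (rule hausdorff_dist_commute)
next
  fix A B assume AB: "A \<in> \<C>" "B \<in> \<C>"
  have A: "A \<noteq> {}" "compact A" and B: "B \<noteq> {}" "compact B" using assms AB by auto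
  show "hausdorff_dist A B = 0 \<longleftrightarrow> A = B"
  proof
    assume 0: "hausdorff_dist A B = 0"
    have "a \<in> B" if "a \<in> A" for a
      using hausdorff_dist_infdist_le(1)[OF A B that] 0 B infdist_nonneg[of a B]
        in_closed_iff_infdist_zero[of B a] by (simp add: compact_imp_closed)
    moreover have "b \<in> A" if "b \<in> B" for b
      using hausdorff_dist_infdist_le(2)[OF A B that] 0 A infdist_nonneg[of b A]
        in_closed_iff_infdist_zero[of A b] by (simp add: compact_imp_closed)
    ultimately show "A = B" by blast
  next
    assume "A = B"
    then have "hausdorff_bound A B 0" by (auto simp: hausdorff_bound_def)
    then show "hausdorff_dist A B = 0"
      using hausdorff_dist_least(2)[OF A B] hausdorff_dist_nonneg[of A B] by force
  qed
next
  fix A B C assume ABC: "A \<in> \<C>" "B \<in> \<C>" "C \<in> \<C>"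
  have A: "A \<noteq> {}" "compact A" and B: "B \<noteq> {}" "compact B" and C: "C \<noteq> {}" "compact C"
    using assms ABC by auto
  have "hausdorff_bound A C (hausdorff_dist A B + hausdorff_dist B C)"
    using infdist_triangle_hausdorff[OF A B C] infdist_triangle_hausdorff[OF C B A]
      hausdorff_dist_nonneg[of A B] hausdorff_dist_nonneg[of B C]
    by (auto simp: hausdorff_bound_def hausdorff_dist_commute add.commute)
  then show "hausdorff_dist A C \<le> hausdorff_dist A B + hausdorff_dist B C"
    using hausdorff_dist_least(2)[OF A C] by blast
qed

text \<open>The usual construction by countable covers, with the normalisation in which a segment
  of length \<open>r\<close> has measure \<open>r\<close>. Boundedness of the covering sets is required because
  \<open>diameter\<close> is real-valued and has no meaning on unbounded sets. Covers by
  fewer sets are included, since the covering sets may be empty.\<close>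

definition hausdorff_premeasure1 :: "real \<Rightarrow> 'a::metric_space set \<Rightarrow> ennreal" where
  "hausdorff_premeasure1 \<delta> A =
     (INF U \<in> {U :: nat \<Rightarrow> 'a set. A \<subseteq> (\<Union>i. U i) \<and> (\<forall>i. bounded (U i) \<and> diameter (U i) \<le> \<delta>)}.
        \<Sum>i. ennreal (diameter (U i)))"

definition hausdorff_measure1 :: "'a::metric_space set \<Rightarrow> ennreal" where
  "hausdorff_measure1 A = (SUP \<delta> \<in> {0<..}. hausdorff_premeasure1 \<delta> A)"

definition continua :: "real \<Rightarrow> 'a::metric_space set set" where
  "continua l = {S. S \<noteq> {} \<and> connected S \<and> compact S \<and> hausdorff_measure1 S \<le> ennreal l}"

definition continua_space :: "real \<Rightarrow> 'a::metric_space set topology" where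
  "continua_space l = Metric_space.mtopology (continua l) hausdorff_dist"

lemma Metric_space_continua: "Metric_space (continua l) hausdorff_dist"
  by (rule Metric_space_hausdorff_dist) (auto simp: continua_def)

lemma topspace_continua_space [simp]: "topspace (continua_space l) = continua l"
  unfolding continua_space_def by (rule Metric_space.topspace_mtopology[OF Metric_space_continua])

lemma first_countable_continua_space: "first_countable (continua_space l)"
  unfolding continua_space_def by (rule Metric_space.first_countable_mtopology[OF Metric_space_continua])

lemma limitin_continua_space_iff:
  "limitin (continua_space l) s S sequentially \<longleftrightarrow>
     S \<in> continua l \<and> eventually (\<lambda>n. s n \<in> continua l) sequentially \<and>
     (\<lambda>n. hausdorff_dist (s n) S) \<longlonglongrightarrow> 0"
  unfolding continua_space_def
  by (rule Metric_space.limitin_metric_dist_null[OF Metric_space_continua])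

text \<open>For compact non-empty \<open>M\<close> the supremum is a maximum (\<open>max_dist_attained\<close>).\<close>

definition max_dist :: "'a::metric_space set \<Rightarrow> 'a set \<Rightarrow> ereal" where
  "max_dist M S = ereal (SUP y\<in>M. infdist y S)"

lemma max_dist_attained:
  assumes "compact M" "M \<noteq> {}"
  shows "\<exists>y\<in>M. max_dist M S = ereal (infdist y S) \<and> (\<forall>z\<in>M. infdist z S \<le> infdist y S)"
proof -
  have "continuous_on M (\<lambda>y. infdist y S)" by (intro continuous_intros)
  then obtain y where y: "y \<in> M" "\<forall>z\<in>M. infdist z S \<le> infdist y S"
    using continuous_attains_sup[OF assms] by blast
  have "(SUP y\<in>M. infdist y S) = infdist y S"
    using y by (intro cSup_eq_maximum) auto
  with y show ?thesis by (auto simp: max_dist_def)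
qed

text \<open>To be used on first-countable spaces only; the functionals matter on \<open>topspace X\<close> alone.\<close>

definition gamma_converges ::
    "'s topology \<Rightarrow> (nat \<Rightarrow> 's \<Rightarrow> ereal) \<Rightarrow> ('s \<Rightarrow> ereal) \<Rightarrow> bool" where
  "gamma_converges X Fs F \<longleftrightarrow>
     (\<forall>x\<in>topspace X. \<forall>xs. (\<forall>n. xs n \<in> topspace X) \<and> limitin X xs x sequentially
        \<longrightarrow> F x \<le> liminf (\<lambda>n. Fs n (xs n))) \<and>
     (\<forall>x\<in>topspace X. \<exists>xs. (\<forall>n. xs n \<in> topspace X) \<and> limitin X xs x sequentially
        \<and> limsup (\<lambda>n. Fs n (xs n)) \<le> F x)"

end

(* The map (M, S) \<mapsto> F_M(S) is 1-Lipschitz in each argument for the Hausdorff distance, so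
   F_{M_n}(S_n) converges to F_M(S) whenever S_n converges to S. This continuous convergence
   gives the liminf inequality at once, and constant sequences serve as recovery sequences. *)

theory Submission
  imports Defs
begin

lemma infdist_attained_compact:
  fixes A :: "'a::metric_space set"
  assumes "A \<noteq> {}" "compact A"
  obtains a where "a \<in> A" "infdist x A = dist x a"
proof -
  have "continuous_on A (dist x)" by (intro continuous_intros)
  then obtain a where a: "a \<in> A" "\<forall>z\<in>A. dist x a \<le> dist x z"
    using continuous_attains_inf[of A "dist x"] assms by blast
  then have "infdist x A = dist x a"
    unfolding infdist_def by (auto intro!: cInf_eq_minimum)
  with a that show thesis by blast
qed

text \<open>A nearest point of \<open>A\<close> to \<open>x\<close> is itself within the Hausdorff
  distance of \<open>C\<close>, so the detour through it gives the bound. The point \<open>x\<close>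
  is arbitrary, which allows its use for points of \<open>M\<close> lying off both sets.\<close>

lemma infdist_le_infdist_plus_hausdorff:
  fixes A C :: "'a::metric_space set"
  assumes "A \<noteq> {}" "compact A" "C \<noteq> {}" "compact C"
  shows "infdist x C \<le> infdist x A + hausdorff_dist A C"
proof -
  obtain a where a: "a \<in> A" "infdist x A = dist x a"
    using infdist_attained_compact assms by blast
  have "infdist x C \<le> infdist a C + dist x a" by (rule infdist_triangle)
  with a hausdorff_dist_infdist_le(1)[OF assms] show ?thesis by fastforce
qed

text \<open>Start at a point \<open>y\<close> of \<open>M\<close> farthest from \<open>S\<close>.
  Exchanging \<open>S\<close> for \<open>T\<close> costs \<open>hausdorff_dist S T\<close>, moving
  \<open>y\<close> to a nearest point of \<open>N\<close> costs \<open>hausdorff_dist M N\<close>,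
  and the maximum over \<open>N\<close> bounds the rest. One direction suffices, as swapping the
  pairs yields the other.\<close>

lemma max_dist_le_plus_hausdorff:
  fixes M N S T :: "'a::metric_space set"
  assumes M: "M \<noteq> {}" "compact M" and N: "N \<noteq> {}" "compact N"
    and S: "S \<noteq> {}" "compact S" and T: "T \<noteq> {}" "compact T"
  shows "max_dist M S \<le> max_dist N T + ereal (hausdorff_dist M N + hausdorff_dist S T)"
proof -
  obtain y where y: "y \<in> M" "max_dist M S = ereal (infdist y S)"
    using max_dist_attained[of M S] M by blast
  obtain w where w: "max_dist N T = ereal (infdist w T)" "\<forall>z\<in>N. infdist z T \<le> infdist w T"
    using max_dist_attained[of N T] N by blast
  obtain z where z: "z \<in> N" "infdist y N = dist y z"
    using infdist_attained_compact N by blast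
  have "infdist y S \<le> infdist y T + hausdorff_dist S T"
    using infdist_le_infdist_plus_hausdorff[OF T S] by (simp add: hausdorff_dist_commute)
  moreover have "infdist y T \<le> infdist z T + dist y z" by (rule infdist_triangle)
  moreover have "dist y z \<le> hausdorff_dist M N"
    using hausdorff_dist_infdist_le(1)[OF M N y(1)] z by simp
  moreover have "infdist z T \<le> infdist w T" using w z by blast
  ultimately show ?thesis using y w by simp
qed

lemma tendsto_max_dist:
  fixes Ms Ss :: "nat \<Rightarrow> 'a::metric_space set"
  assumes Ms: "\<And>i. Ms i \<noteq> {}" "\<And>i. compact (Ms i)" and M: "M \<noteq> {}" "compact M"
    and Ss: "\<And>i. Ss i \<noteq> {}" "\<And>i. compact (Ss i)" and S: "S \<noteq> {}" "compact S"
    and "(\<lambda>i. hausdorff_dist (Ms i) M) \<longlonglongrightarrow> 0" "(\<lambda>i. hausdorff_dist (Ss i) S) \<longlonglongrightarrow> 0"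
  shows "(\<lambda>i. max_dist (Ms i) (Ss i)) \<longlonglongrightarrow> max_dist M S"
proof -
  \<comment> \<open>The real number inside \<open>max_dist\<close>: differences and norms are taken
    in the reals, and only the final limit is lifted to \<open>ereal\<close>.\<close>
  define f where "f M S = (SUP y\<in>M. infdist y S)" for M S :: "'a set"
  define e where "e i = hausdorff_dist (Ms i) M + hausdorff_dist (Ss i) S" for i
  have f: "max_dist M S = ereal (f M S)" for M S :: "'a set"
    by (simp add: max_dist_def f_def)
  have e: "e \<longlonglongrightarrow> 0"
    unfolding e_def using tendsto_add[OF assms(9,10)] by simp
  \<comment> \<open>The Lipschitz bound applied in both directions controls the absolute value; the
    free indices of \<open>Ms\<close> and \<open>Ss\<close> are both set to
    \<open>i\<close>.\<close>
  have "norm (f (Ms i) (Ss i) - f M S) \<le> e i" for i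
    using max_dist_le_plus_hausdorff[OF Ms M Ss S, of i i]
      max_dist_le_plus_hausdorff[OF M Ms S Ss, of i i]
    by (simp add: f e_def hausdorff_dist_commute[of M] hausdorff_dist_commute[of S])
  then have "(\<lambda>i. f (Ms i) (Ss i) - f M S) \<longlonglongrightarrow> 0"
    by (intro Lim_null_comparison[OF _ e]) simp
  then show ?thesis
    by (simp add: f LIM_zero_iff)
qed

theorem proposition5p1:
  fixes l :: real
    and Ms :: "nat \<Rightarrow> (real ^ 'd) set"
    and M :: "(real ^ 'd) set"
  assumes "l > 0"
    and "\<And>i. Ms i \<noteq> {}" and "\<And>i. compact (Ms i)"
    and "M \<noteq> {}" and "compact M"
    and "(\<lambda>i. hausdorff_dist (Ms i) M) \<longlonglongrightarrow> 0"
  shows "gamma_converges (continua_space l) (\<lambda>i. max_dist (Ms i)) (max_dist M)"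
proof -
  \<comment> \<open>Continuous convergence for arbitrary \<open>Ss\<close>, so that it serves both
    halves of the definition.\<close>
  have conv: "(\<lambda>n. max_dist (Ms n) (Ss n)) \<longlonglongrightarrow> max_dist M S"
    if "\<And>n. Ss n \<in> continua l" "limitin (continua_space l) Ss S sequentially"
    for Ss :: "nat \<Rightarrow> (real ^ 'd) set" and S
    using that assms
    by (intro tendsto_max_dist) (auto simp: limitin_continua_space_iff continua_def)
  show ?thesis
    unfolding gamma_converges_def
  proof (intro conjI ballI allI impI)
    fix S and Ss :: "nat \<Rightarrow> (real ^ 'd) set"
    assume "(\<forall>n. Ss n \<in> topspace (continua_space l)) \<and>
      limitin (continua_space l) Ss S sequentially"
    \<comment> \<open>The limit exists, so the lower bound holds with equality.\<close>
    then have "liminf (\<lambda>n. max_dist (Ms n) (Ss n)) = max_dist M S"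
      by (intro lim_imp_Liminf conv) auto
    then show "max_dist M S \<le> liminf (\<lambda>n. max_dist (Ms n) (Ss n))" by simp
  next
    fix S :: "(real ^ 'd) set"
    assume S: "S \<in> topspace (continua_space l)"
    then have lim: "limitin (continua_space l) (\<lambda>n. S) S sequentially"
      by (simp add: limitin_const_iff)
    \<comment> \<open>Along the constant sequence only the sets \<open>Ms n\<close> vary.\<close>
    have "limsup (\<lambda>n. max_dist (Ms n) S) = max_dist M S"
      using S lim by (intro lim_imp_Limsup conv) auto
    with S lim show "\<exists>Ss. (\<forall>n. Ss n \<in> topspace (continua_space l)) \<and>
        limitin (continua_space l) Ss S sequentially \<and>
        limsup (\<lambda>n. max_dist (Ms n) (Ss n)) \<le> max_dist M S"
      by (intro exI[of _ "\<lambda>n. S"]) simp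
  qed
qed

end
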